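(* Let $\mathbb F$ be a field and $a\in\mathbb F$. The graph parameter $\operatorname{wm}_a$, as a function on simple graphs, is not expressible as a graph homomorphism function over $\mathbb F$; that is, there is no $\mathbb F$-weighted graph $H$ such that $\operatorname{wm}_a(G)=\hom(G,H)$ for every simple graph $G$.
   Context: For a graph $G$, $\operatorname{wm}_a(G)=\sum_{M}a^{|V(G)|-2|M|}$, the sum over all matchings $M$ of $G$ (including the empty matching), i.e. each vertex not covered by $M$ contributes a factor $a$, with the convention $a^0=1$ even if $a=0$. (Thus $\operatorname{wm}_0$ counts perfect matchings in $\mathbb F$, and $\operatorname{wm}_1$ counts all matchings.) An $\mathbb F$-weighted graph $H$ is given by $q=|V(H)|\ge0$, vertex weights $\alpha_1,\dots,\alpha_q\in\mathbb F\setminus\{0\}$ and a symmetric matrix $B=(\beta_{ij})\in\mathbb F^{q\times q}$; $\hom(G,H)=\sum_{\phi:V(G)\to[q]}\prod_{u\in V(G)}\alpha_{\phi(u)}\prod_{uv\in E(G)}\beta_{\phi(u)\phi(v)}$ (empty products equal $1$). *)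

theory Defs
  imports Main "HOL-Library.FuncSet" "HOL-Library.Disjoint_Sets"
begin

text \<open>
  A graph is given by its vertex set \<open>V\<close> and its edge set \<open>E\<close>, an edge being the unordered pair
  \<open>{u, v}\<close> of its end points. The graph without vertices is a simple graph.
\<close>

definition simple_graph :: "'v set \<Rightarrow> 'v set set \<Rightarrow> bool" where
  "simple_graph V E \<longleftrightarrow>
     finite V \<and> (\<forall>e\<in>E. \<exists>u v. u \<in> V \<and> v \<in> V \<and> u \<noteq> v \<and> e = {u, v})"

definition matchings :: "'v set set \<Rightarrow> 'v set set set" where
  "matchings E = {M. M \<subseteq> E \<and> disjoint M}"

text \<open>
  The subtraction on \<open>nat\<close> does not truncate, since a matching \<open>M\<close> covers \<open>2 * card M\<close> vertices
  (see \<open>card_matching_le\<close> below). The convention \<open>a ^ 0 = 1\<close> for \<open>a = 0\<close> is that of the library.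
\<close>

definition wm :: "'a::field \<Rightarrow> 'v set \<Rightarrow> 'v set set \<Rightarrow> 'a" where
  "wm a V E = (\<Sum>M\<in>matchings E. a ^ (card V - 2 * card M))"

text \<open>
  A weighted graph has vertex set \<open>{..<q}\<close>; values of \<open>\<alpha>\<close> and \<open>\<beta>\<close> at indices
  outside this range are irrelevant.
\<close>

definition weighted_graph :: "nat \<Rightarrow> (nat \<Rightarrow> 'a::field) \<Rightarrow> (nat \<Rightarrow> nat \<Rightarrow> 'a) \<Rightarrow> bool" where
  "weighted_graph q \<alpha> \<beta> \<longleftrightarrow>
     (\<forall>i<q. \<alpha> i \<noteq> 0) \<and> (\<forall>i<q. \<forall>j<q. \<beta> i j = \<beta> j i)"

text \<open>
  The factor contributed by an unordered edge; by symmetry of \<open>\<beta>\<close> it does not depend on the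
  order of the end points (see \<open>edge_weight_eq\<close> below).
\<close>

definition edge_weight :: "(nat \<Rightarrow> nat \<Rightarrow> 'a) \<Rightarrow> ('v \<Rightarrow> nat) \<Rightarrow> 'v set \<Rightarrow> 'a" where
  "edge_weight \<beta> \<phi> e = (THE w. \<exists>u v. e = {u, v} \<and> w = \<beta> (\<phi> u) (\<phi> v))"

definition hom_weighted ::
  "'v set \<Rightarrow> 'v set set \<Rightarrow> nat \<Rightarrow> (nat \<Rightarrow> 'a::field) \<Rightarrow> (nat \<Rightarrow> nat \<Rightarrow> 'a) \<Rightarrow> 'a" where
  "hom_weighted V E q \<alpha> \<beta> =
     (\<Sum>\<phi> \<in> V \<rightarrow>\<^sub>E {..<q}. (\<Prod>u\<in>V. \<alpha> (\<phi> u)) * (\<Prod>e\<in>E. edge_weight \<beta> \<phi> e))"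

lemma edge_weight_eq:
  assumes "weighted_graph q \<alpha> \<beta>" "\<phi> u < q" "\<phi> v < q"
  shows "edge_weight \<beta> \<phi> {u, v} = \<beta> (\<phi> u) (\<phi> v)"
  unfolding edge_weight_def
proof (rule the_equality)
  show "\<exists>x y. {u, v} = {x, y} \<and> \<beta> (\<phi> u) (\<phi> v) = \<beta> (\<phi> x) (\<phi> y)"
    by blast
next
  fix w assume "\<exists>x y. {u, v} = {x, y} \<and> w = \<beta> (\<phi> x) (\<phi> y)"
  then show "w = \<beta> (\<phi> u) (\<phi> v)"
    using assms by (auto simp: weighted_graph_def doubleton_eq_iff)
qed

lemma card_matching_le:
  assumes "simple_graph V E" "M \<in> matchings E"
  shows "2 * card M \<le> card V"
proof -
  have edge: "e \<subseteq> V \<and> card e = 2" if "e \<in> M" for e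
    using assms that unfolding simple_graph_def matchings_def by fastforce
  have fin: "finite V"
    using assms(1) by (simp add: simple_graph_def)
  have "card (\<Union>M) = (\<Sum>e\<in>M. card e)"
    using assms(2) edge fin
    by (intro card_Union_disjoint) (auto simp: matchings_def intro: finite_subset)
  also have "\<dots> = 2 * card M"
    using edge by simp
  finally have "2 * card M = card (\<Union>M)"
    by simp
  also have "\<dots> \<le> card V"
    using edge fin by (intro card_mono) auto
  finally show ?thesis .
qed

end

(* Stars alone suffice. If sigma_i is the sum over j of alpha_j * beta_ij, the star with k leaves has
   homomorphism number equal to the sum over i of alpha_i * sigma_i^k, while wm_a of it is
   a * a^k + k * a^(k-1). Extending linearly from the powers X^k to polynomials P, expressibility
   would give: the sum over i of alpha_i * P(sigma_i) equals a * P(a) + P'(a). This fails for P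
   equal to X - a times the product of X - sigma_i over all i with sigma_i \<noteq> a. *)

theory Submission
  imports Defs "HOL-Computational_Algebra.Polynomial"
begin

definition star_edges :: "nat \<Rightarrow> nat set set" where
  "star_edges k = (\<lambda>j. {0, j}) ` {1..k}"

lemma inj_on_star_edge: "inj_on (\<lambda>j::nat. {0, j}) {1..k}"
  by (auto simp: inj_on_def doubleton_eq_iff)

lemma simple_graph_star: "simple_graph {..k} (star_edges k)"
  unfolding simple_graph_def star_edges_def by fastforce

text \<open>Any two edges share the centre \<open>0\<close>, so a matching cannot contain two of
  them.\<close>

lemma matchings_star: "matchings (star_edges k) = insert {} ((\<lambda>e. {e}) ` star_edges k)"
proof (intro equalityI subsetI)
  fix M assume "M \<in> matchings (star_edges k)"
  then have sub: "M \<subseteq> star_edges k" and disj: "disjoint M"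
    by (auto simp: matchings_def)
  have "e = f" if "e \<in> M" "f \<in> M" for e f
  proof (rule ccontr)
    assume "e \<noteq> f"
    then have "e \<inter> f = {}"
      using disj that by (auto simp: disjoint_def)
    moreover have "0 \<in> e" "0 \<in> f"
      using sub that by (auto simp: star_edges_def)
    ultimately show False by blast
  qed
  then show "M \<in> insert {} ((\<lambda>e. {e}) ` star_edges k)"
    using sub by blast
next
  fix M assume "M \<in> insert {} ((\<lambda>e. {e}) ` star_edges k)"
  then show "M \<in> matchings (star_edges k)"
    by (auto simp: matchings_def disjoint_def)
qed

text \<open>The empty matching leaves \<open>k + 1\<close> vertices uncovered, each of the
  \<open>k\<close> single edges leaves \<open>k - 1\<close>. For \<open>k = 0\<close> the truncated
  exponent is harmless, since its coefficient is zero.\<close>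

lemma wm_star: "wm a {..k} (star_edges k) = a * a ^ k + of_nat k * a ^ (k - 1)"
proof -
  have "wm a {..k} (star_edges k) =
      a ^ Suc k + (\<Sum>M\<in>(\<lambda>e. {e}) ` star_edges k. a ^ (Suc k - 2 * card M))"
    unfolding wm_def matchings_star
    by (subst sum.insert) (auto simp: star_edges_def)
  also have "(\<Sum>M\<in>(\<lambda>e. {e}) ` star_edges k. a ^ (Suc k - 2 * card M)) =
      of_nat (card (star_edges k)) * a ^ (k - 1)"
    by (subst sum.reindex) auto
  also have "card (star_edges k) = k"
    unfolding star_edges_def by (subst card_image[OF inj_on_star_edge]) simp
  finally show ?thesis by simp
qed

text \<open>Once the image \<open>i\<close> of the centre is fixed, the leaves are mapped
  independently, so by distributivity the sum over their maps is a product of \<open>k\<close> equal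
  factors.\<close>

lemma hom_weighted_star:
  assumes "weighted_graph q \<alpha> \<beta>"
  shows "hom_weighted {..k} (star_edges k) q \<alpha> \<beta> =
    (\<Sum>i<q. \<alpha> i * (\<Sum>j<q. \<alpha> j * \<beta> i j) ^ k)"
proof -
  let ?w = "\<lambda>\<phi>. (\<Prod>u\<in>{..k}. \<alpha> (\<phi> u)) * (\<Prod>e\<in>star_edges k. edge_weight \<beta> \<phi> e)"
  let ?L = "{1..k} \<rightarrow>\<^sub>E {..<q}"
  have V: "{..k} = insert 0 {1..k}"
    by auto
  \<comment> \<open>A map of the star is encoded as the image \<open>i\<close> of the centre and a
    map \<open>\<psi>\<close> of the leaves.\<close>
  have w: "?w (\<psi>(0 := i)) = \<alpha> i * (\<Prod>j\<in>{1..k}. \<alpha> (\<psi> j) * \<beta> i (\<psi> j))"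
    if "i < q" "\<psi> \<in> ?L" for i \<psi>
  proof -
    have "(\<Prod>u\<in>{..k}. \<alpha> ((\<psi>(0 := i)) u)) = \<alpha> i * (\<Prod>j\<in>{1..k}. \<alpha> (\<psi> j))"
      unfolding V by (subst prod.insert) (auto intro!: prod.cong)
    moreover have "(\<Prod>e\<in>star_edges k. edge_weight \<beta> (\<psi>(0 := i)) e) =
        (\<Prod>j\<in>{1..k}. edge_weight \<beta> (\<psi>(0 := i)) {0, j})"
      unfolding star_edges_def by (subst prod.reindex[OF inj_on_star_edge]) simp
    moreover have "\<dots> = (\<Prod>j\<in>{1..k}. \<beta> i (\<psi> j))"
    proof (rule prod.cong)
      fix j assume j: "j \<in> {1..k}"
      then have "\<psi> j < q"
        using that(2) by (auto simp: PiE_iff)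
      then show "edge_weight \<beta> (\<psi>(0 := i)) {0, j} = \<beta> i (\<psi> j)"
        using j that(1) by (subst edge_weight_eq[OF assms]) auto
    qed simp
    ultimately show ?thesis
      by (simp add: prod.distrib mult.assoc)
  qed
  have "hom_weighted {..k} (star_edges k) q \<alpha> \<beta> =
      (\<Sum>(i, \<psi>)\<in>{..<q} \<times> ?L. ?w (\<psi>(0 := i)))"
  proof -
    have "{..k} \<rightarrow>\<^sub>E {..<q} = (\<lambda>(i, \<psi>). \<psi>(0 := i)) ` ({..<q} \<times> ?L)"
      unfolding V by (rule PiE_insert_eq)
    moreover have "inj_on (\<lambda>(i, \<psi>). \<psi>(0 := i)) ({..<q} \<times> ?L)"
      by (rule inj_combinator) simp
    ultimately show ?thesis
      unfolding hom_weighted_def by (simp add: sum.reindex case_prod_unfold)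
  qed
  also have "\<dots> = (\<Sum>i<q. \<Sum>\<psi>\<in>?L. \<alpha> i * (\<Prod>j\<in>{1..k}. \<alpha> (\<psi> j) * \<beta> i (\<psi> j)))"
    unfolding sum.cartesian_product[symmetric] by (intro sum.cong refl w) auto
  also have "\<dots> = (\<Sum>i<q. \<alpha> i * (\<Prod>u\<in>{1..k}. \<Sum>j<q. \<alpha> j * \<beta> i j))"
    by (subst prod_sum_PiE) (simp_all add: sum_distrib_left)
  finally show ?thesis by simp
qed

lemma poly_pderiv_altdef:
  fixes p :: "'a::field poly"
  shows "poly (pderiv p) x = (\<Sum>k\<le>degree p. coeff p k * (of_nat k * x ^ (k - 1)))"
proof -
  have "poly (pderiv p) x = poly (pderiv (\<Sum>k\<le>degree p. monom (coeff p k) k)) x"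
    by (simp add: poly_as_sum_of_monoms)
  also have "\<dots> = (\<Sum>k\<le>degree p. poly (pderiv (monom (coeff p k) k)) x)"
    \<comment> \<open>Order 1 of this rule is additivity of \<open>pderiv\<close> over finite
      sums.\<close>
    using higher_pderiv_sum[of 1 "\<lambda>k. monom (coeff p k) k" "{..degree p}"]
    by (simp add: poly_sum)
  also have "\<dots> = (\<Sum>k\<le>degree p. coeff p k * (of_nat k * x ^ (k - 1)))"
    by (simp add: pderiv_monom poly_monom mult_ac)
  finally show ?thesis .
qed

text \<open>Values at finitely many points cannot determine the derivative at \<open>a\<close>, in
  any characteristic. The points \<open>s i\<close> may repeat or coincide with
  \<open>a\<close>.\<close>

lemma power_sums_neq_derivation:
  fixes a :: "'a::field"
  assumes "finite I"
  shows "\<not> (\<forall>k. (\<Sum>i\<in>I. c i * s i ^ k) = b * a ^ k + of_nat k * a ^ (k - 1))"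
proof
  assume eq: "\<forall>k. (\<Sum>i\<in>I. c i * s i ^ k) = b * a ^ k + of_nat k * a ^ (k - 1)"
  \<comment> \<open>Both sides are linear in \<open>p\<close>, and \<open>eq\<close> is the case of
    the monomials.\<close>
  have L: "(\<Sum>i\<in>I. c i * poly p (s i)) = b * poly p a + poly (pderiv p) a" for p
  proof -
    have "(\<Sum>i\<in>I. c i * poly p (s i)) =
        (\<Sum>k\<le>degree p. coeff p k * (\<Sum>i\<in>I. c i * s i ^ k))"
      unfolding poly_altdef sum_distrib_left
      by (subst sum.swap) (simp add: mult_ac)
    also have "\<dots> = b * poly p a + poly (pderiv p) a"
      unfolding poly_pderiv_altdef poly_altdef[of p]
      using eq by (simp add: distrib_left sum.distrib sum_distrib_left mult_ac)
    finally show ?thesis .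
  qed
  \<comment> \<open>Leaving out the points equal to \<open>a\<close> keeps \<open>Q\<close> nonzero
    at \<open>a\<close>; the extra factor \<open>X - a\<close> below takes care of them.\<close>
  define Q where "Q = (\<Prod>i\<in>{i\<in>I. s i \<noteq> a}. [:- s i, 1:])"
  have "poly ([:- a, 1:] * Q) (s i) = 0" if "i \<in> I" for i
    using that assms by (auto simp: Q_def poly_prod)
  then have "b * poly ([:- a, 1:] * Q) a + poly (pderiv ([:- a, 1:] * Q)) a = 0"
    unfolding L[symmetric] by (intro sum.neutral) (simp del: mult_pCons_left poly_mult)
  \<comment> \<open>At \<open>a\<close> the \<open>b\<close> term vanishes, and by the product rule
    the derivative of \<open>(X - a) * Q\<close> is the value of \<open>Q\<close>.\<close>
  then have "poly Q a = 0"
    by (simp add: pderiv_mult pderiv_pCons del: mult_pCons_left)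
  then show False
    using assms by (auto simp: Q_def poly_prod)
qed

theorem theorem4p4:
  fixes a :: "'a::field"
  shows "\<not> (\<exists>(q::nat) (\<alpha> :: nat \<Rightarrow> 'a) (\<beta> :: nat \<Rightarrow> nat \<Rightarrow> 'a).
            weighted_graph q \<alpha> \<beta> \<and>
            (\<forall>(V :: nat set) (E :: nat set set). simple_graph V E \<longrightarrow>
               wm a V E = hom_weighted V E q \<alpha> \<beta>))"
proof (intro notI, elim exE conjE)
  fix q and \<alpha> :: "nat \<Rightarrow> 'a" and \<beta>
  assume H: "weighted_graph q \<alpha> \<beta>"
    and eq: "\<forall>(V :: nat set) E. simple_graph V E \<longrightarrow> wm a V E = hom_weighted V E q \<alpha> \<beta>"
  have "(\<Sum>i<q. \<alpha> i * (\<Sum>j<q. \<alpha> j * \<beta> i j) ^ k) = a * a ^ k + of_nat k * a ^ (k - 1)" for k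
    using eq simple_graph_star[of k] unfolding wm_star[symmetric] hom_weighted_star[OF H, symmetric]
    by simp
  \<comment> \<open>Here \<open>c\<close> is \<open>\<alpha>\<close>, \<open>s i\<close> is the
    weighted row sum of \<open>\<beta>\<close> at \<open>i\<close>, and \<open>b\<close> is
    \<open>a\<close>.\<close>
  then show False
    using power_sums_neq_derivation[OF finite_lessThan[of q]] by fast
qed

end
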